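(* Let $p$ be a prime, let $A,B$ be groups, and let $G\le A\times B$ be a virtual $p$-group. (a) If $M$ is a Sylow $p$-subgroup of $G$, then, for $i=1,2$, $\overline{M}_i$ is a Sylow $p$-subgroup of $\overline{G}_i$ and $M_i$ is a Sylow $p$-subgroup of $G_i$. (b) Conversely, if $N\le G$ has Goursat quintuple $(\overline{N}_1,N_1,\overline{N}_2,N_2,\theta_N)$ with $\overline{N}_i$ a Sylow $p$-subgroup of $\overline{G}_i$ and $N_i$ a Sylow $p$-subgroup of $G_i$ for $i=1,2$, then $N$ is a Sylow $p$-subgroup of $G$.
   Context: Groups may be infinite. A $p$-group is a group in which every element has order a power of $p$. A virtual $p$-group is a group having a subgroup of finite index that is a $p$-group. A Sylow $p$-subgroup of an arbitrary group is a maximal $p$-subgroup. For any subgroup $H\le A\times B$ (in particular for $H=G,M,N$), with neutral elements written $e$: $\overline{H}_1=\{a\in A\mid (a,b)\in H\text{ for some }b\in B\}$, $H_1=\{a\in A\mid (a,e)\in H\}$, $\overline{H}_2=\{b\in B\mid (a,b)\in H\text{ for some }a\in A\}$, $H_2=\{b\in B\mid (e,b)\in H\}$. Then $H_i\unlhd\overline{H}_i$, and the Goursat quintuple of $H$ is $(\overline{H}_1,H_1,\overline{H}_2,H_2,\theta_H)$, where $\theta_H:\overline{H}_1/H_1\to\overline{H}_2/H_2$ is the isomorphism given by $\theta_H([a])=[b]$ whenever $(a,b)\in H$. *)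

theory Defs
  imports "HOL-Algebra.Multiplicative_Group" "HOL-Computational_Algebra.Primes"
begin

text \<open>Groups need not be finite. \<^term>\<open>group.ord\<close> is 0 on elements of infinite order, so for
  \<^prop>\<open>p > 0\<close> the condition below forces every element to have finite order.\<close>

definition p_group :: "nat \<Rightarrow> ('a, 'm) monoid_scheme \<Rightarrow> bool" where
  "p_group p G \<longleftrightarrow> group G \<and> (\<forall>x\<in>carrier G. \<exists>k. group.ord G x = p ^ k)"

definition p_subgroup :: "nat \<Rightarrow> ('a, 'm) monoid_scheme \<Rightarrow> 'a set \<Rightarrow> bool" where
  "p_subgroup p G P \<longleftrightarrow> subgroup P G \<and> p_group p (G\<lparr>carrier := P\<rparr>)"

definition virtual_p_group :: "nat \<Rightarrow> ('a, 'm) monoid_scheme \<Rightarrow> bool" where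
  "virtual_p_group p G \<longleftrightarrow> group G \<and> (\<exists>P. p_subgroup p G P \<and> finite (rcosets\<^bsub>G\<^esub> P))"

definition sylow_subgroup :: "nat \<Rightarrow> ('a, 'm) monoid_scheme \<Rightarrow> 'a set \<Rightarrow> bool" where
  "sylow_subgroup p G P \<longleftrightarrow>
     p_subgroup p G P \<and> (\<forall>Q. p_subgroup p G Q \<and> P \<subseteq> Q \<longrightarrow> Q = P)"

text \<open>In the next definitions \<open>H\<close> is (the carrier of) a subgroup of \<^term>\<open>A \<times>\<times> B\<close>;
  \<open>proj1\<close>, \<open>proj2\<close> are the overlined groups of the Goursat quintuple.\<close>

definition proj1 :: "('a, 'm) monoid_scheme \<Rightarrow> ('b, 'n) monoid_scheme \<Rightarrow> ('a \<times> 'b) set \<Rightarrow> 'a set" where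
  "proj1 A B H = {a \<in> carrier A. \<exists>b\<in>carrier B. (a, b) \<in> H}"

definition fibre1 :: "('a, 'm) monoid_scheme \<Rightarrow> ('b, 'n) monoid_scheme \<Rightarrow> ('a \<times> 'b) set \<Rightarrow> 'a set" where
  "fibre1 A B H = {a \<in> carrier A. (a, \<one>\<^bsub>B\<^esub>) \<in> H}"

definition proj2 :: "('a, 'm) monoid_scheme \<Rightarrow> ('b, 'n) monoid_scheme \<Rightarrow> ('a \<times> 'b) set \<Rightarrow> 'b set" where
  "proj2 A B H = {b \<in> carrier B. \<exists>a\<in>carrier A. (a, b) \<in> H}"

definition fibre2 :: "('a, 'm) monoid_scheme \<Rightarrow> ('b, 'n) monoid_scheme \<Rightarrow> ('a \<times> 'b) set \<Rightarrow> 'b set" where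
  "fibre2 A B H = {b \<in> carrier B. (\<one>\<^bsub>A\<^esub>, b) \<in> H}"

abbreviation quot1 :: "('a, 'm) monoid_scheme \<Rightarrow> ('b, 'n) monoid_scheme \<Rightarrow> ('a \<times> 'b) set \<Rightarrow> 'a set monoid" where
  "quot1 A B H \<equiv> A\<lparr>carrier := proj1 A B H\<rparr> Mod fibre1 A B H"

abbreviation quot2 :: "('a, 'm) monoid_scheme \<Rightarrow> ('b, 'n) monoid_scheme \<Rightarrow> ('a \<times> 'b) set \<Rightarrow> 'b set monoid" where
  "quot2 A B H \<equiv> B\<lparr>carrier := proj2 A B H\<rparr> Mod fibre2 A B H"

text \<open>The value on a coset is chosen through any pair of \<open>H\<close> representing it; that this does not
  depend on the pair, and gives an isomorphism, is \<open>goursat_theta_eq\<close> and \<open>goursat_theta_iso\<close>.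
  Outside the quotient group the map takes the value \<^term>\<open>undefined\<close>, so that it is determined
  by its values on the quotient.\<close>

definition goursat_theta ::
  "('a, 'm) monoid_scheme \<Rightarrow> ('b, 'n) monoid_scheme \<Rightarrow> ('a \<times> 'b) set \<Rightarrow> 'a set \<Rightarrow> 'b set" where
  "goursat_theta A B H = (\<lambda>X\<in>carrier (quot1 A B H).
     THE Y. \<exists>a b. (a, b) \<in> H \<and> X = fibre1 A B H #>\<^bsub>A\<^esub> a \<and> Y = fibre2 A B H #>\<^bsub>B\<^esub> b)"

definition goursat_quintuple ::
  "('a, 'm) monoid_scheme \<Rightarrow> ('b, 'n) monoid_scheme \<Rightarrow> ('a \<times> 'b) set \<Rightarrow>
     'a set \<times> 'a set \<times> 'b set \<times> 'b set \<times> ('a set \<Rightarrow> 'b set)" where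
  "goursat_quintuple A B H =
     (proj1 A B H, fibre1 A B H, proj2 A B H, fibre2 A B H, goursat_theta A B H)"

context
  fixes A :: "('a, 'm) monoid_scheme" and B :: "('b, 'n) monoid_scheme" and H :: "('a \<times> 'b) set"
  assumes A: "group A" and B: "group B" and H: "subgroup H (A \<times>\<times> B)"
begin

interpretation A: group A by (rule A)
interpretation B: group B by (rule B)
interpretation AB: group "A \<times>\<times> B" by (rule DirProd_group[OF A B])

private lemma H_carr: "(a, b) \<in> H \<Longrightarrow> a \<in> carrier A \<and> b \<in> carrier B"
  using subgroup.subset[OF H] by auto

private lemma H_one: "(\<one>\<^bsub>A\<^esub>, \<one>\<^bsub>B\<^esub>) \<in> H"
  using subgroup.one_closed[OF H] by simp

private lemma H_mult: "(a, b) \<in> H \<Longrightarrow> (a', b') \<in> H \<Longrightarrow> (a \<otimes>\<^bsub>A\<^esub> a', b \<otimes>\<^bsub>B\<^esub> b') \<in> H"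
  using subgroup.m_closed[OF H, of "(a, b)" "(a', b')"] by simp

private lemma H_inv: "(a, b) \<in> H \<Longrightarrow> (inv\<^bsub>A\<^esub> a, inv\<^bsub>B\<^esub> b) \<in> H"
  using subgroup.m_inv_closed[OF H, of "(a, b)"] H_carr A B by simp

lemma proj1_subgroup: "subgroup (proj1 A B H) A"
  by (rule A.subgroupI) (auto simp: proj1_def dest: H_carr intro: H_one H_mult H_inv)

lemma proj2_subgroup: "subgroup (proj2 A B H) B"
  by (rule B.subgroupI) (auto simp: proj2_def dest: H_carr intro: H_one H_mult H_inv)

lemma fibre1_subgroup: "subgroup (fibre1 A B H) A"
  using H_mult[of _ "\<one>\<^bsub>B\<^esub>" _ "\<one>\<^bsub>B\<^esub>"] H_inv[of _ "\<one>\<^bsub>B\<^esub>"]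
  by (intro A.subgroupI) (auto simp: fibre1_def intro: H_one)

lemma fibre2_subgroup: "subgroup (fibre2 A B H) B"
  using H_mult[of "\<one>\<^bsub>A\<^esub>" _ "\<one>\<^bsub>A\<^esub>"] H_inv[of "\<one>\<^bsub>A\<^esub>"]
  by (intro B.subgroupI) (auto simp: fibre2_def intro: H_one)

lemma fibre1_normal: "fibre1 A B H \<lhd> A\<lparr>carrier := proj1 A B H\<rparr>"
proof -
  interpret P: group "A\<lparr>carrier := proj1 A B H\<rparr>"
    by (rule A.subgroup_imp_group[OF proj1_subgroup])
  have sub: "fibre1 A B H \<subseteq> proj1 A B H"
    by (auto simp: fibre1_def proj1_def)
  show ?thesis
  proof (rule P.normal_invI)
    show "subgroup (fibre1 A B H) (A\<lparr>carrier := proj1 A B H\<rparr>)"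
      by (rule A.subgroup_incl[OF fibre1_subgroup proj1_subgroup sub])
  next
    fix x h assume x: "x \<in> carrier (A\<lparr>carrier := proj1 A B H\<rparr>)" and h: "h \<in> fibre1 A B H"
    then obtain b where b: "(x, b) \<in> H" by (auto simp: proj1_def)
    have "(x \<otimes>\<^bsub>A\<^esub> h \<otimes>\<^bsub>A\<^esub> inv\<^bsub>A\<^esub> x, b \<otimes>\<^bsub>B\<^esub> \<one>\<^bsub>B\<^esub> \<otimes>\<^bsub>B\<^esub> inv\<^bsub>B\<^esub> b) \<in> H"
      using h b by (intro H_mult H_inv) (auto simp: fibre1_def)
    then have "x \<otimes>\<^bsub>A\<^esub> h \<otimes>\<^bsub>A\<^esub> inv\<^bsub>A\<^esub> x \<in> fibre1 A B H"
      using H_carr[OF b] by (auto simp: fibre1_def dest: H_carr)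
    then show "x \<otimes>\<^bsub>A\<lparr>carrier := proj1 A B H\<rparr>\<^esub> h \<otimes>\<^bsub>A\<lparr>carrier := proj1 A B H\<rparr>\<^esub>
        inv\<^bsub>A\<lparr>carrier := proj1 A B H\<rparr>\<^esub> x \<in> fibre1 A B H"
      using x A.m_inv_consistent[OF proj1_subgroup] by simp
  qed
qed

lemma fibre2_normal: "fibre2 A B H \<lhd> B\<lparr>carrier := proj2 A B H\<rparr>"
proof -
  interpret P: group "B\<lparr>carrier := proj2 A B H\<rparr>"
    by (rule B.subgroup_imp_group[OF proj2_subgroup])
  have sub: "fibre2 A B H \<subseteq> proj2 A B H"
    by (auto simp: fibre2_def proj2_def)
  show ?thesis
  proof (rule P.normal_invI)
    show "subgroup (fibre2 A B H) (B\<lparr>carrier := proj2 A B H\<rparr>)"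
      by (rule B.subgroup_incl[OF fibre2_subgroup proj2_subgroup sub])
  next
    fix x h assume x: "x \<in> carrier (B\<lparr>carrier := proj2 A B H\<rparr>)" and h: "h \<in> fibre2 A B H"
    then obtain a where a: "(a, x) \<in> H" by (auto simp: proj2_def)
    have "(a \<otimes>\<^bsub>A\<^esub> \<one>\<^bsub>A\<^esub> \<otimes>\<^bsub>A\<^esub> inv\<^bsub>A\<^esub> a, x \<otimes>\<^bsub>B\<^esub> h \<otimes>\<^bsub>B\<^esub> inv\<^bsub>B\<^esub> x) \<in> H"
      using h a by (intro H_mult H_inv) (auto simp: fibre2_def)
    then have "x \<otimes>\<^bsub>B\<^esub> h \<otimes>\<^bsub>B\<^esub> inv\<^bsub>B\<^esub> x \<in> fibre2 A B H"
      using H_carr[OF a] by (auto simp: fibre2_def dest: H_carr)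
    then show "x \<otimes>\<^bsub>B\<lparr>carrier := proj2 A B H\<rparr>\<^esub> h \<otimes>\<^bsub>B\<lparr>carrier := proj2 A B H\<rparr>\<^esub>
        inv\<^bsub>B\<lparr>carrier := proj2 A B H\<rparr>\<^esub> x \<in> fibre2 A B H"
      using x B.m_inv_consistent[OF proj2_subgroup] by simp
  qed
qed

private lemma coset_eq1:
  assumes "a \<in> carrier A" "a' \<in> carrier A"
  shows "fibre1 A B H #>\<^bsub>A\<^esub> a = fibre1 A B H #>\<^bsub>A\<^esub> a' \<longleftrightarrow> a \<otimes>\<^bsub>A\<^esub> inv\<^bsub>A\<^esub> a' \<in> fibre1 A B H"
  using A.repr_independence[OF _ assms(2) fibre1_subgroup]
    A.rcos_self[OF assms(1) fibre1_subgroup]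
    subgroup.rcos_module[OF fibre1_subgroup A assms(2,1)] by auto

private lemma coset_eq2:
  assumes "b \<in> carrier B" "b' \<in> carrier B"
  shows "fibre2 A B H #>\<^bsub>B\<^esub> b = fibre2 A B H #>\<^bsub>B\<^esub> b' \<longleftrightarrow> b \<otimes>\<^bsub>B\<^esub> inv\<^bsub>B\<^esub> b' \<in> fibre2 A B H"
  using B.repr_independence[OF _ assms(2) fibre2_subgroup]
    B.rcos_self[OF assms(1) fibre2_subgroup]
    subgroup.rcos_module[OF fibre2_subgroup B assms(2,1)] by auto

private lemma fibre_transfer:
  assumes ab: "(a, b) \<in> H" "(a', b') \<in> H"
  shows "fibre1 A B H #>\<^bsub>A\<^esub> a = fibre1 A B H #>\<^bsub>A\<^esub> a' \<longleftrightarrow>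
         fibre2 A B H #>\<^bsub>B\<^esub> b = fibre2 A B H #>\<^bsub>B\<^esub> b'"
proof -
  define x where "x = a \<otimes>\<^bsub>A\<^esub> inv\<^bsub>A\<^esub> a'"
  define y where "y = b \<otimes>\<^bsub>B\<^esub> inv\<^bsub>B\<^esub> b'"
  have xy: "(x, y) \<in> H"
    unfolding x_def y_def by (intro H_mult H_inv ab)
  have c: "x \<in> carrier A" "y \<in> carrier B" using H_carr[OF xy] by auto
  have "(\<one>\<^bsub>A\<^esub>, y) \<in> H" if "(x, \<one>\<^bsub>B\<^esub>) \<in> H"
    using H_mult[OF H_inv[OF that] xy] c by simp
  moreover have "(x, \<one>\<^bsub>B\<^esub>) \<in> H" if "(\<one>\<^bsub>A\<^esub>, y) \<in> H"
    using H_mult[OF H_inv[OF that] xy] c by simp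
  ultimately have "x \<in> fibre1 A B H \<longleftrightarrow> y \<in> fibre2 A B H"
    using c by (auto simp: fibre1_def fibre2_def)
  then show ?thesis
    using coset_eq1 coset_eq2 H_carr[OF ab(1)] H_carr[OF ab(2)] by (auto simp: x_def y_def)
qed

private lemma carrier_quot1:
  "carrier (quot1 A B H) = {fibre1 A B H #>\<^bsub>A\<^esub> a | a b. (a, b) \<in> H}"
  by (auto simp: carrier_FactGroup r_coset_def proj1_def dest: H_carr)

private lemma carrier_quot2:
  "carrier (quot2 A B H) = {fibre2 A B H #>\<^bsub>B\<^esub> b | a b. (a, b) \<in> H}"
  by (auto simp: carrier_FactGroup r_coset_def proj2_def dest: H_carr)

lemma goursat_theta_eq:
  assumes "(a, b) \<in> H"
  shows "goursat_theta A B H (fibre1 A B H #>\<^bsub>A\<^esub> a) = fibre2 A B H #>\<^bsub>B\<^esub> b"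
proof -
  have "fibre1 A B H #>\<^bsub>A\<^esub> a \<in> carrier (quot1 A B H)"
    using assms unfolding carrier_quot1 by blast
  moreover have "(THE Y. \<exists>a' b'. (a', b') \<in> H \<and> fibre1 A B H #>\<^bsub>A\<^esub> a = fibre1 A B H #>\<^bsub>A\<^esub> a' \<and>
      Y = fibre2 A B H #>\<^bsub>B\<^esub> b') = fibre2 A B H #>\<^bsub>B\<^esub> b"
    using assms fibre_transfer by (intro the_equality) blast+
  ultimately show ?thesis by (simp add: goursat_theta_def)
qed

lemma goursat_theta_iso: "goursat_theta A B H \<in> iso (quot1 A B H) (quot2 A B H)"
proof (rule isoI)
  have m1: "(fibre1 A B H #>\<^bsub>A\<^esub> a) <#>\<^bsub>A\<lparr>carrier := proj1 A B H\<rparr>\<^esub> (fibre1 A B H #>\<^bsub>A\<^esub> a') =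
      fibre1 A B H #>\<^bsub>A\<^esub> (a \<otimes>\<^bsub>A\<^esub> a')" if "(a, b) \<in> H" "(a', b') \<in> H" for a b a' b'
  proof -
    have "a \<in> proj1 A B H" "a' \<in> proj1 A B H" using that H_carr by (auto simp: proj1_def)
    then show ?thesis using normal.rcos_sum[OF fibre1_normal, of a a'] by (simp add: r_coset_def)
  qed
  have m2: "(fibre2 A B H #>\<^bsub>B\<^esub> b) <#>\<^bsub>B\<lparr>carrier := proj2 A B H\<rparr>\<^esub> (fibre2 A B H #>\<^bsub>B\<^esub> b') =
      fibre2 A B H #>\<^bsub>B\<^esub> (b \<otimes>\<^bsub>B\<^esub> b')" if "(a, b) \<in> H" "(a', b') \<in> H" for a b a' b'
  proof -
    have "b \<in> proj2 A B H" "b' \<in> proj2 A B H" using that H_carr by (auto simp: proj2_def)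
    then show ?thesis using normal.rcos_sum[OF fibre2_normal, of b b'] by (simp add: r_coset_def)
  qed
  show "goursat_theta A B H \<in> hom (quot1 A B H) (quot2 A B H)"
  proof (rule homI)
    fix X assume "X \<in> carrier (quot1 A B H)"
    then show "goursat_theta A B H X \<in> carrier (quot2 A B H)"
      unfolding carrier_quot1 carrier_quot2 using goursat_theta_eq by blast
  next
    fix X Y assume "X \<in> carrier (quot1 A B H)" "Y \<in> carrier (quot1 A B H)"
    then obtain a b a' b' where ab: "(a, b) \<in> H" "(a', b') \<in> H"
      and XY: "X = fibre1 A B H #>\<^bsub>A\<^esub> a" "Y = fibre1 A B H #>\<^bsub>A\<^esub> a'"
      unfolding carrier_quot1 by blast
    show "goursat_theta A B H (X \<otimes>\<^bsub>quot1 A B H\<^esub> Y) =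
        goursat_theta A B H X \<otimes>\<^bsub>quot2 A B H\<^esub> goursat_theta A B H Y"
      unfolding XY mult_FactGroup m1[OF ab] goursat_theta_eq[OF ab(1)] goursat_theta_eq[OF ab(2)]
        m2[OF ab] by (rule goursat_theta_eq[OF H_mult[OF ab]])
  qed
  show "bij_betw (goursat_theta A B H) (carrier (quot1 A B H)) (carrier (quot2 A B H))"
    unfolding bij_betw_def
  proof
    show "inj_on (goursat_theta A B H) (carrier (quot1 A B H))"
      unfolding carrier_quot1 by (rule inj_onI) (clarify, simp only: goursat_theta_eq fibre_transfer)
    show "goursat_theta A B H ` carrier (quot1 A B H) = carrier (quot2 A B H)"
      unfolding carrier_quot1 carrier_quot2 by (force simp: goursat_theta_eq)
  qed
qed

end

end

theory Submission
  imports Defs "HOL-Algebra.Group_Action" "HOL-Algebra.Sylow"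
begin

text \<open>A virtual \<open>p\<close>-group \<open>G\<close> acts on the finitely many cosets of a \<open>p\<close>-subgroup \<open>P\<close> of finite index,
  which gives a homomorphism from \<open>G\<close> onto a finite group with kernel inside \<open>P\<close>. The preimage of a
  Sylow subgroup of this finite group is a \<open>p\<close>-subgroup \<open>T\<close> of finite index prime to \<open>p\<close>. A
  \<open>p\<close>-group acting on a finite set of size prime to \<open>p\<close> has a fixed point, so every \<open>p\<close>-subgroup has
  a conjugate inside \<open>T\<close>; hence every Sylow \<open>p\<close>-subgroup \<open>M\<close> is conjugate to \<open>T\<close>, and its index is
  prime to \<open>p\<close>. In (a), for a projection \<open>f\<close> the index of \<open>f(M)\<close> in \<open>f(G)\<close> divides that of \<open>M\<close>, and
  elements of the image have finite order, so the same fixed-point argument makes \<open>f(M)\<close> Sylow;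
  for the fibres, the intersection of \<open>M\<close> with a normal subgroup is Sylow, by that argument
  on the cosets of \<open>M\<close>. Part (b) holds because \<open>N\<close> is an extension of one projection by the opposite
  fibre: a \<open>p\<close>-subgroup containing \<open>N\<close> has the same projection and fibre, hence equals \<open>N\<close>.\<close>

section \<open>p-subgroups described by p-power torsion\<close>

text \<open>As p is prime, the divisors of powers of p are again powers of p, so the order of x is
  such a power as soon as some p-power kills x. Powers in \<open>P\<close> are powers in
  \<open>G\<close>, so the condition can be tested in the ambient group.\<close>

lemma p_subgroup_iff:
  assumes "prime p" "group G"
  shows "p_subgroup p G P \<longleftrightarrow> subgroup P G \<and> (\<forall>x\<in>P. \<exists>k. x [^]\<^bsub>G\<^esub> (p ^ k :: nat) = \<one>\<^bsub>G\<^esub>)"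
proof (cases "subgroup P G")
  case True
  interpret G: group G by fact
  interpret P: group "G\<lparr>carrier := P\<rparr>" by (rule G.subgroup_imp_group[OF True])
  have "(\<exists>k. P.ord x = p ^ k) \<longleftrightarrow> (\<exists>k. x [^]\<^bsub>G\<^esub> (p ^ k :: nat) = \<one>\<^bsub>G\<^esub>)" if "x \<in> P" for x
  proof -
    have "x [^]\<^bsub>G\<^esub> n = \<one>\<^bsub>G\<^esub> \<longleftrightarrow> P.ord x dvd n" for n :: nat
      using P.pow_eq_id[of x n] that by (simp flip: G.nat_pow_consistent)
    then show ?thesis
      using divides_primepow_nat[OF assms(1)] by (metis dvd_refl)
  qed
  then show ?thesis using True P.group_axioms by (simp add: p_subgroup_def p_group_def)
qed (simp add: p_subgroup_def)

section \<open>Actions on cosets and fixed points of p-groups\<close>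

text \<open>Translating right cosets by \<open>g\<close> is a right action; the inverse turns it
  into a left one. The map is restricted to the cosets because elements of \<open>BijGroup\<close>
  are extensional.\<close>

lemma (in group) r_coset_inv_action:
  assumes H: "subgroup H G"
  shows "group_action G (rcosets H) (\<lambda>g. \<lambda>C\<in>rcosets H. C #> inv g)"
proof -
  have sub: "C \<subseteq> carrier G" if "C \<in> rcosets H" for C
    using that rcosets_subset_PowG[OF H] by auto
  have cl: "C #> g \<in> rcosets H" if "C \<in> rcosets H" "g \<in> carrier G" for C g
    using that subgroup.subset[OF H] by (auto simp: RCOSETS_def coset_mult_assoc)
  have bij: "(\<lambda>C\<in>rcosets H. C #> inv g) \<in> Bij (rcosets H)" if "g \<in> carrier G" for g
    unfolding Bij_def
  proof (intro IntI CollectI)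
    show "bij_betw (\<lambda>C\<in>rcosets H. C #> inv g) (rcosets H) (rcosets H)"
      by (rule bij_betw_byWitness[where f' = "\<lambda>C. C #> g"])
        (use that in \<open>auto simp: cl coset_mult_assoc sub\<close>)
  qed auto
  have "(\<lambda>g. \<lambda>C\<in>rcosets H. C #> inv g) \<in> hom G (BijGroup (rcosets H))"
    by (rule homI)
      (auto simp: BijGroup_def bij compose_def cl coset_mult_assoc sub inv_mult_group fun_eq_iff)
  then show ?thesis
    by (simp add: group_action_def group_hom_def group_hom_axioms_def is_group group_BijGroup)
qed

lemma finite_carrier_BijGroup:
  assumes "finite E"
  shows "finite (carrier (BijGroup E))"
proof (rule finite_subset)
  show "carrier (BijGroup E) \<subseteq> PiE E (\<lambda>_. E)"
    by (auto simp: BijGroup_def Bij_def bij_betw_def PiE_def)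
  show "finite (PiE E (\<lambda>_. E))" using assms by (simp add: finite_PiE)
qed

text \<open>This is Cauchy's theorem: a subgroup of prime order q contains an element of order q,
  and that order divides a power of p.\<close>

lemma prime_dvd_order_p_group:
  assumes "prime p" "group F" "finite (carrier F)" "prime q" "q dvd order F"
    and tors: "\<And>x. x \<in> carrier F \<Longrightarrow> \<exists>k. x [^]\<^bsub>F\<^esub> (p ^ k :: nat) = \<one>\<^bsub>F\<^esub>"
  shows "q = p"
proof -
  interpret F: group F by fact
  \<comment> \<open>Sylow's theorem with exponent 1 gives a subgroup of order exactly q.\<close>
  obtain m where "order F = q ^ 1 * m" using assms(5) by auto
  then obtain H where H: "subgroup H F" "card H = q"
    using sylow_thm[OF assms(4,2) _ assms(3), of 1 m] by auto
  interpret H: group "F\<lparr>carrier := H\<rparr>" by (rule F.subgroup_imp_group[OF H(1)])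
  have "1 < q" using assms(4) prime_gt_1_nat by blast
  then have "\<not> H \<subseteq> {\<one>\<^bsub>F\<^esub>}"
    using H(2) card_mono[of "{\<one>\<^bsub>F\<^esub>}" H] by auto
  then obtain x where x: "x \<in> H" "x \<noteq> \<one>\<^bsub>F\<^esub>" by auto
  have xF: "x \<in> carrier F" using x subgroup.subset[OF H(1)] by auto
  have "x [^]\<^bsub>F\<^esub> q = \<one>\<^bsub>F\<^esub>"
    using H.pow_order_eq_1[of x] x H(2) by (simp add: order_def flip: F.nat_pow_consistent)
  then have "F.ord x dvd q" using xF by (simp add: F.pow_eq_id)
  moreover have "F.ord x \<noteq> 1" using x xF F.ord_eq_1 by auto
  ultimately have q: "F.ord x = q" using assms(4) by (metis prime_nat_iff)
  obtain k where "x [^]\<^bsub>F\<^esub> (p ^ k :: nat) = \<one>\<^bsub>F\<^esub>" using tors[OF xF] by auto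
  then have "q dvd p ^ k" using xF q by (simp add: F.pow_eq_id)
  then have "q dvd p" using assms(4) prime_dvd_power by blast
  then show ?thesis using assms(1,4) primes_dvd_imp_eq by blast
qed

text \<open>Some orbit has size prime to p, since the sizes add up to \<open>card E\<close>.
  \<open>Q\<close> may be infinite, so orbits are counted for its finite image in the permutations
  of \<open>E\<close>, whose order has no prime factor but p.\<close>

lemma p_group_action_fixed_point:
  assumes "prime p" "group_action Q E \<phi>" "\<not> p dvd card E"
    and tors: "\<And>x. x \<in> carrier Q \<Longrightarrow> \<exists>k. x [^]\<^bsub>Q\<^esub> (p ^ k :: nat) = \<one>\<^bsub>Q\<^esub>"
  shows "\<exists>x\<in>E. \<forall>g\<in>carrier Q. \<phi> g x = x"
proof -
  interpret a: group_action Q E \<phi> by fact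
  interpret h: group_hom Q "BijGroup E" \<phi> by (rule a.group_hom)
  \<comment> \<open>An infinite set has \<open>card\<close> 0, which p divides.\<close>
  have finE: "finite E" using assms(3) card.infinite by fastforce
  define F where "F = BijGroup E\<lparr>carrier := \<phi> ` carrier Q\<rparr>"
  have sub: "subgroup (\<phi> ` carrier Q) (BijGroup E)" by (rule h.img_is_subgroup)
  interpret F: group F unfolding F_def by (rule h.H.subgroup_imp_group[OF sub])
  have finF: "finite (carrier F)"
    using finite_carrier_BijGroup[OF finE] subgroup.subset[OF sub] finite_subset
    by (auto simp: F_def)
  have "group_action (BijGroup E) E (\<lambda>f. f)"
    by (simp add: group_action_def group_hom_def group_hom_axioms_def h.H.group_axioms hom_def)
  then interpret F: group_action F E "\<lambda>f. f"
    unfolding F_def using sub by (rule group_action.induced_action)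
  have torsF: "\<exists>k. y [^]\<^bsub>F\<^esub> (p ^ k :: nat) = \<one>\<^bsub>F\<^esub>" if y: "y \<in> carrier F" for y
  proof -
    from y obtain x where x: "x \<in> carrier Q" "y = \<phi> x" by (auto simp: F_def)
    then obtain k where "x [^]\<^bsub>Q\<^esub> (p ^ k :: nat) = \<one>\<^bsub>Q\<^esub>" using tors by blast
    then have "y [^]\<^bsub>F\<^esub> (p ^ k :: nat) = \<one>\<^bsub>F\<^esub>"
      using x h.hom_nat_pow[of x "p ^ k"] by (simp add: F_def flip: h.H.nat_pow_consistent)
    then show ?thesis by blast
  qed
  have "\<exists>U\<in>orbits F E (\<lambda>f. f). \<not> p dvd card U"
  proof (rule ccontr)
    assume "\<not> ?thesis"
    then have "p dvd (\<Sum>U\<in>orbits F E (\<lambda>f. f). card U)" by (intro dvd_sum) auto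
    also have "\<dots> = card E" using F.disjoint_sum[OF finE, of "\<lambda>_. 1::nat"] by simp
    finally show False using assms(3) by simp
  qed
  then obtain x where x: "x \<in> E" "\<not> p dvd card (orbit F (\<lambda>f. f) x)" by (auto simp: orbits_def)
  have "card (orbit F (\<lambda>f. f) x) dvd order F"
    using F.orbit_stabilizer_theorem[OF x(1)] by (metis dvd_triv_left)
  then have "q = p" if "prime q" "q dvd card (orbit F (\<lambda>f. f) x)" for q
    using that prime_dvd_order_p_group[OF assms(1) F.group_axioms finF that(1) _ torsF] dvd_trans
    by blast
  \<comment> \<open>Every prime factor of this size is p, and p is not one.\<close>
  then have "card (orbit F (\<lambda>f. f) x) = 1"
    using x(2) prime_factor_nat by blast
  then obtain y where "orbit F (\<lambda>f. f) x = {y}" using card_1_singletonE by blast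
  then have "orbit F (\<lambda>f. f) x = {x}" using F.orbit_refl[OF x(1)] by auto
  then have "\<phi> g x = x" if "g \<in> carrier Q" for g
    using that by (auto simp: orbit_def F_def)
  then show ?thesis using x(1) by blast
qed

section \<open>Indices of images and preimages\<close>

lemma (in group_hom) image_r_coset:
  assumes "C \<subseteq> carrier G" "x \<in> carrier G"
  shows "h ` (C #> x) = h ` C #>\<^bsub>H\<^esub> h x"
proof -
  have "h (c \<otimes> x) = h c \<otimes>\<^bsub>H\<^esub> h x" if "c \<in> C" for c using assms that by auto
  then show ?thesis by (simp add: r_coset_def image_UN)
qed

lemma (in group_hom) image_rcosets:
  assumes "h ` carrier G = carrier H" "M \<subseteq> carrier G"
  shows "(`) h ` (rcosets M) = rcosets\<^bsub>H\<^esub> (h ` M)"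
proof -
  have "(`) h ` (rcosets M) = (\<lambda>x. h ` (M #> x)) ` carrier G" by (auto simp: RCOSETS_def)
  also have "\<dots> = (\<lambda>y. h ` M #>\<^bsub>H\<^esub> y) ` h ` carrier G"
    using assms(2) by (auto simp: image_r_coset)
  finally show ?thesis using assms(1) by (auto simp: RCOSETS_def)
qed

text \<open>Taking images maps the cosets of \<open>M\<close> onto those of \<open>h\<close>
  M\<open>. Right translation by\<close>x\<open>carries the fibre over\<close>h \<open>M\<close>
  bijectively to the fibre over its translate by \<open>h x\<close>, so all fibres have equal
  size.\<close>

lemma (in group_hom) card_rcosets_image_dvd:
  assumes surj: "h ` carrier G = carrier H" and M: "subgroup M G"
  shows "card (rcosets\<^bsub>H\<^esub> (h ` M)) dvd card (rcosets M)"
\<comment> \<open>With infinitely many cosets \<open>card\<close> is 0, which everything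
  divides.\<close>
proof (cases "finite (rcosets M)")
  case True
  note MG = subgroup.subset[OF M]
  have sub: "C \<subseteq> carrier G" if "C \<in> rcosets M" for C
    using that G.rcosets_subset_PowG[OF M] by auto
  have cl: "C #> g \<in> rcosets M" if "C \<in> rcosets M" "g \<in> carrier G" for C g
    using that MG by (auto simp: RCOSETS_def G.coset_mult_assoc)
  have hM: "h ` M \<subseteq> carrier H" using MG by auto
  define fib where "fib Y = {C \<in> rcosets M. h ` C = Y}" for Y
  have "card (fib Y) = card (fib (h ` M))" if "Y \<in> rcosets\<^bsub>H\<^esub> (h ` M)" for Y
  proof -
    from that obtain x where x: "x \<in> carrier G" "Y = h ` M #>\<^bsub>H\<^esub> h x"
      unfolding RCOSETS_def surj[symmetric] by auto
    have "h ` (C #> g) = h ` C #>\<^bsub>H\<^esub> h g" if "C \<in> rcosets M" "g \<in> carrier G" for C g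
      using that sub by (simp add: image_r_coset)
    then have "bij_betw (\<lambda>C. C #> x) (fib (h ` M)) (fib Y)"
      by (intro bij_betw_byWitness[where f' = "\<lambda>C. C #> inv x"])
        (use x hM in \<open>simp_all add: fib_def image_subset_iff cl G.coset_mult_assoc
          H.coset_mult_assoc sub\<close>)
    then show ?thesis using bij_betw_same_card by metis
  qed
  moreover have "card (rcosets M) = (\<Sum>Y\<in>rcosets\<^bsub>H\<^esub> (h ` M). card (fib Y))"
    using sum.image_gen[OF True, of "\<lambda>_. 1::nat" "(`) h"] image_rcosets[OF surj MG]
    by (simp add: fib_def)
  ultimately show ?thesis by simp
qed simp

text \<open>The preimage contains the kernel, so distinct cosets of it have distinct images.\<close>

lemma (in group_hom) card_rcosets_vimage:
  assumes surj: "h ` carrier G = carrier H" and S: "subgroup S H"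
  shows "card (rcosets {x \<in> carrier G. h x \<in> S}) = card (rcosets\<^bsub>H\<^esub> S)"
proof -
  define M where "M = {x \<in> carrier G. h x \<in> S}"
  have MG: "M \<subseteq> carrier G" by (auto simp: M_def)
  have M: "subgroup M G"
    using S by (intro G.subgroupI)
      (auto simp: M_def subgroup.m_closed subgroup.m_inv_closed subgroup.one_closed
        intro!: exI[of _ "\<one>"])
  have hM: "h ` M = S" using surj subgroup.subset[OF S] by (auto simp: M_def)
  have "inj_on ((`) h) (rcosets M)"
  proof (rule inj_onI)
    fix C D assume "C \<in> rcosets M" "D \<in> rcosets M" and eq: "h ` C = h ` D"
    then obtain x y where xy: "x \<in> carrier G" "y \<in> carrier G" "C = M #> x" "D = M #> y"
      by (auto simp: RCOSETS_def)
    have "S #>\<^bsub>H\<^esub> h x = S #>\<^bsub>H\<^esub> h y" using eq xy MG hM by (simp add: image_r_coset)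
    then have "h x \<in> S #>\<^bsub>H\<^esub> h y" using H.rcos_self[OF _ S, of "h x"] xy by auto
    then have "h x \<otimes>\<^bsub>H\<^esub> inv\<^bsub>H\<^esub> h y \<in> S"
      using subgroup.rcos_module_imp[OF S H.group_axioms] xy by auto
    then have "x \<otimes> inv y \<in> M" using xy by (simp add: M_def)
    then have "x \<in> M #> y"
      using subgroup.rcos_module_rev[OF M G.group_axioms] xy by auto
    then show "C = D" using G.repr_independence[OF _ xy(2) M] xy by auto
  qed
  then show ?thesis
    using card_image image_rcosets[OF surj MG] hM by (metis M_def)
qed

section \<open>p-subgroups under restriction, images and preimages\<close>

lemma (in group) p_subgroup_restrict_iff:
  assumes "subgroup K G"
  shows "p_subgroup p (G\<lparr>carrier := K\<rparr>) P \<longleftrightarrow> p_subgroup p G P \<and> P \<subseteq> K"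
proof -
  have "subgroup P (G\<lparr>carrier := K\<rparr>) \<longleftrightarrow> subgroup P G \<and> P \<subseteq> K"
    using incl_subgroup[OF assms] subgroup_incl[OF _ assms] subgroup.subset by fastforce
  then show ?thesis by (auto simp: p_subgroup_def)
qed

lemma (in group_hom) p_subgroup_image:
  assumes "prime p" "p_subgroup p G P"
  shows "p_subgroup p H (h ` P)"
proof -
  have P: "subgroup P G" and tors: "\<forall>x\<in>P. \<exists>k. x [^] (p ^ k :: nat) = \<one>"
    using assms by (auto simp: p_subgroup_iff)
  have "\<exists>k. h x [^]\<^bsub>H\<^esub> (p ^ k :: nat) = \<one>\<^bsub>H\<^esub>" if "x \<in> P" for x
    using that tors subgroup.subset[OF P] hom_nat_pow[of x] by (metis hom_one subsetD)
  then show ?thesis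
    using assms(1) subgroup_img_is_subgroup[OF P] by (auto simp: p_subgroup_iff)
qed

text \<open>An extension of a p-group by a p-group is a p-group: one p-power moves \<open>x\<close>
  into the kernel, a second one kills it.\<close>

lemma (in group_hom) p_subgroup_vimage:
  assumes "prime p" "p_subgroup p H S"
    and ker: "\<And>x. \<lbrakk>x \<in> carrier G; h x = \<one>\<^bsub>H\<^esub>\<rbrakk> \<Longrightarrow> \<exists>k. x [^] (p ^ k :: nat) = \<one>"
  shows "p_subgroup p G {x \<in> carrier G. h x \<in> S}"
proof -
  have S: "subgroup S H" and tors: "\<forall>x\<in>S. \<exists>k. x [^]\<^bsub>H\<^esub> (p ^ k :: nat) = \<one>\<^bsub>H\<^esub>"
    using assms by (auto simp: p_subgroup_iff)
  have "subgroup {x \<in> carrier G. h x \<in> S} G"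
    using S by (intro G.subgroupI)
      (auto simp: subgroup.m_closed subgroup.m_inv_closed subgroup.one_closed
        intro!: exI[of _ "\<one>"])
  moreover have "\<exists>k. x [^] (p ^ k :: nat) = \<one>" if x: "x \<in> carrier G" "h x \<in> S" for x
  proof -
    obtain k where "h x [^]\<^bsub>H\<^esub> (p ^ k :: nat) = \<one>\<^bsub>H\<^esub>" using tors x by auto
    then have "h (x [^] (p ^ k :: nat)) = \<one>\<^bsub>H\<^esub>" using x by (simp add: hom_nat_pow)
    then obtain l where "(x [^] (p ^ k :: nat)) [^] (p ^ l :: nat) = \<one>"
      using ker x by (meson G.nat_pow_closed)
    then have "x [^] (p ^ (k + l) :: nat) = \<one>" using x by (simp add: G.nat_pow_pow power_add)
    then show ?thesis by blast
  qed
  ultimately show ?thesis using assms(1) by (simp add: p_subgroup_iff)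
qed

section \<open>Finite quotients of virtual p-groups and the index of a Sylow subgroup\<close>

text \<open>\<open>F\<close> is the group of permutations that \<open>G\<close> induces on the
  finitely many cosets of \<open>P\<close>. An element acting trivially fixes the coset
  \<open>P\<close> itself, hence lies in \<open>P\<close>.\<close>

lemma virtual_p_group_finite_image:
  fixes G :: "('a, 'm) monoid_scheme"
  assumes "prime p" "virtual_p_group p G"
  obtains F :: "('a set \<Rightarrow> 'a set) monoid" and h
  where "group_hom G F h" "h ` carrier G = carrier F" "finite (carrier F)"
    "\<And>x. \<lbrakk>x \<in> carrier G; h x = \<one>\<^bsub>F\<^esub>\<rbrakk> \<Longrightarrow> \<exists>k. x [^]\<^bsub>G\<^esub> (p ^ k :: nat) = \<one>\<^bsub>G\<^esub>"
proof -
  interpret G: group G using assms(2) by (simp add: virtual_p_group_def)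
  obtain P where P: "subgroup P G" "\<forall>x\<in>P. \<exists>k. x [^]\<^bsub>G\<^esub> (p ^ k :: nat) = \<one>\<^bsub>G\<^esub>"
    and fin: "finite (rcosets\<^bsub>G\<^esub> P)"
    using assms G.group_axioms by (auto simp: virtual_p_group_def p_subgroup_iff)
  define \<phi> where "\<phi> = (\<lambda>g. \<lambda>C\<in>rcosets\<^bsub>G\<^esub> P. C #>\<^bsub>G\<^esub> inv\<^bsub>G\<^esub> g)"
  interpret a: group_action G "rcosets\<^bsub>G\<^esub> P" \<phi>
    unfolding \<phi>_def by (rule G.r_coset_inv_action[OF P(1)])
  interpret h: group_hom G "BijGroup (rcosets\<^bsub>G\<^esub> P)" \<phi> by (rule a.group_hom)
  define F where "F = BijGroup (rcosets\<^bsub>G\<^esub> P)\<lparr>carrier := \<phi> ` carrier G\<rparr>"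
  have sub: "subgroup (\<phi> ` carrier G) (BijGroup (rcosets\<^bsub>G\<^esub> P))" by (rule h.img_is_subgroup)
  have F: "group F" unfolding F_def by (rule h.H.subgroup_imp_group[OF sub])
  show ?thesis
  proof (rule that[of F \<phi>])
    show "group_hom G F \<phi>"
      using F h.homh by (auto simp: group_hom_def group_hom_axioms_def hom_def F_def G.group_axioms)
    show "\<phi> ` carrier G = carrier F" by (simp add: F_def)
    show "finite (carrier F)"
      using finite_carrier_BijGroup[OF fin] subgroup.subset[OF sub] finite_subset
      by (auto simp: F_def)
    fix x assume x: "x \<in> carrier G" "\<phi> x = \<one>\<^bsub>F\<^esub>"
    have PR: "P \<in> rcosets\<^bsub>G\<^esub> P" by (rule subgroup.subgroup_in_rcosets[OF P(1) G.group_axioms])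
    have "P #>\<^bsub>G\<^esub> inv\<^bsub>G\<^esub> x = \<phi> x P" using PR by (simp add: \<phi>_def)
    also have "\<dots> = P" using PR x by (simp add: F_def BijGroup_def)
    finally have "inv\<^bsub>G\<^esub> x \<in> P" using G.coset_join1 P(1) x(1) by blast
    then have "x \<in> P" using subgroup.m_inv_closed[OF P(1)] x(1) by fastforce
    then show "\<exists>k. x [^]\<^bsub>G\<^esub> (p ^ k :: nat) = \<one>\<^bsub>G\<^esub>" using P(2) by blast
  qed
qed

text \<open>The power \<open>order F\<close> of \<open>x\<close> lies in the kernel, where a p-power
  kills it.\<close>

lemma virtual_p_group_torsion:
  fixes G :: "('a, 'm) monoid_scheme"
  assumes "prime p" "virtual_p_group p G" "x \<in> carrier G"
  shows "\<exists>n>0. x [^]\<^bsub>G\<^esub> (n :: nat) = \<one>\<^bsub>G\<^esub>"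
proof -
  obtain F :: "('a set \<Rightarrow> 'a set) monoid" and h where h: "group_hom G F h" and surj: "h ` carrier G = carrier F"
    and fin: "finite (carrier F)"
    and ker: "\<And>x. \<lbrakk>x \<in> carrier G; h x = \<one>\<^bsub>F\<^esub>\<rbrakk> \<Longrightarrow> \<exists>k. x [^]\<^bsub>G\<^esub> (p ^ k :: nat) = \<one>\<^bsub>G\<^esub>"
    using virtual_p_group_finite_image[OF assms(1,2)] by blast
  interpret h: group_hom G F h by (rule h)
  have "h (x [^]\<^bsub>G\<^esub> order F) = \<one>\<^bsub>F\<^esub>"
    using h.H.pow_order_eq_1 assms(3) by (simp add: h.hom_nat_pow)
  then obtain k where "(x [^]\<^bsub>G\<^esub> order F) [^]\<^bsub>G\<^esub> (p ^ k :: nat) = \<one>\<^bsub>G\<^esub>"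
    using ker assms(3) by blast
  then have "x [^]\<^bsub>G\<^esub> (order F * p ^ k) = \<one>\<^bsub>G\<^esub>" using assms(3) by (simp add: h.G.nat_pow_pow)
  moreover have "order F * p ^ k > 0"
    using fin h.H.order_gt_0_iff_finite prime_gt_0_nat[OF assms(1)] by simp
  ultimately show ?thesis by blast
qed

text \<open>\<open>Q\<close> acts on the cosets of \<open>L\<close>, and a fixed coset \<open>L g\<close> means \<open>g Q g\<^sup>-\<^sup>1 \<subseteq> L\<close>.\<close>

lemma (in group) p_subgroup_conjugate_into:
  assumes "prime p" "p_subgroup p G Q" and L: "subgroup L G" and "\<not> p dvd card (rcosets L)"
  shows "\<exists>g\<in>carrier G. \<forall>q\<in>Q. g \<otimes> q \<otimes> inv g \<in> L"
proof -
  have Q: "subgroup Q G" and tors: "\<forall>x\<in>Q. \<exists>k. x [^] (p ^ k :: nat) = \<one>"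
    using assms by (auto simp: p_subgroup_iff)
  note act = group_action.induced_action[OF r_coset_inv_action[OF L] Q]
  obtain C where C: "C \<in> rcosets L" "\<And>q. q \<in> Q \<Longrightarrow> C #> inv q = C"
    using p_group_action_fixed_point[OF assms(1) act assms(4)] tors
    by (auto simp flip: nat_pow_consistent)
  then obtain g where g: "g \<in> carrier G" "C = L #> g" by (auto simp: RCOSETS_def)
  have "g \<otimes> q \<otimes> inv g \<in> L" if q: "q \<in> Q" for q
  proof -
    have qG: "q \<in> carrier G" using q subgroup.subset[OF Q] by auto
    \<comment> \<open>The action translates by inverses, so the fixed coset is tested at the inverse
      of \<open>q\<close>.\<close>
    have "L #> g = (L #> g) #> q"
      using C(2)[OF subgroup.m_inv_closed[OF Q q]] g qG by simp
    also have "\<dots> = L #> (g \<otimes> q)" using g qG subgroup.subset[OF L] by (simp add: coset_mult_assoc)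
    finally have "g \<otimes> q \<in> L #> g" using rcos_self[OF _ L, of "g \<otimes> q"] g qG by auto
    then show ?thesis using subgroup.rcos_module_imp[OF L is_group g(1)] g qG by auto
  qed
  then show ?thesis using g by blast
qed

lemma (in group) conjugation_group_hom:
  assumes "g \<in> carrier G"
  shows "group_hom G G (\<lambda>x. g \<otimes> x \<otimes> inv g)"
proof -
  have "inv g \<otimes> (g \<otimes> z) = z" if "z \<in> carrier G" for z
    using assms that by (simp flip: m_assoc)
  then have "g \<otimes> (x \<otimes> y) \<otimes> inv g = (g \<otimes> x \<otimes> inv g) \<otimes> (g \<otimes> y \<otimes> inv g)"
    if "x \<in> carrier G" "y \<in> carrier G" for x y
    using assms that by (simp add: m_assoc)
  then show ?thesis
    using assms by (simp add: group_hom_def group_hom_axioms_def hom_def is_group)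
qed

text \<open>The preimage \<open>T\<close> of a Sylow subgroup of the finite quotient has index prime
  to p. A conjugate of \<open>M\<close> lies in \<open>T\<close>, and maximality of \<open>M\<close>
  makes \<open>M\<close> the full preimage of \<open>T\<close> under that conjugation, so the
  indices agree.\<close>

lemma sylow_subgroup_index_coprime:
  fixes G :: "('a, 'm) monoid_scheme"
  assumes "prime p" "virtual_p_group p G" "sylow_subgroup p G M"
  shows "\<not> p dvd card (rcosets\<^bsub>G\<^esub> M)"
proof -
  obtain F :: "('a set \<Rightarrow> 'a set) monoid" and h where h: "group_hom G F h" and surj: "h ` carrier G = carrier F"
    and fin: "finite (carrier F)"
    and ker: "\<And>x. \<lbrakk>x \<in> carrier G; h x = \<one>\<^bsub>F\<^esub>\<rbrakk> \<Longrightarrow> \<exists>k. x [^]\<^bsub>G\<^esub> (p ^ k :: nat) = \<one>\<^bsub>G\<^esub>"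
    using virtual_p_group_finite_image[OF assms(1,2)] by blast
  interpret h: group_hom G F h by (rule h)
  have pos: "order F \<noteq> 0" using fin h.H.order_gt_0_iff_finite by simp
  \<comment> \<open>\<open>m\<close> is the part of the order prime to p; it becomes the index of
    \<open>S\<close>.\<close>
  obtain m where m: "order F = p ^ multiplicity p (order F) * m" "\<not> p dvd m"
    using multiplicity_decompose'[of "order F" p] pos assms(1) not_prime_unit by metis
  obtain S where S: "subgroup S F" and cS: "card S = p ^ multiplicity p (order F)"
    using sylow_thm[OF assms(1) h.H.group_axioms m(1) fin] by auto
  have "card (rcosets\<^bsub>F\<^esub> S) = m"
    using h.H.lagrange[OF S] m(1) cS pos by (metis mult.commute mult_cancel1 mult_is_0)
  moreover have pS: "p_subgroup p F S"
  proof -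
    interpret S: group "F\<lparr>carrier := S\<rparr>" by (rule h.H.subgroup_imp_group[OF S])
    have "x [^]\<^bsub>F\<^esub> (p ^ multiplicity p (order F)) = \<one>\<^bsub>F\<^esub>" if "x \<in> S" for x
      using S.pow_order_eq_1[of x] that cS by (simp add: order_def flip: h.H.nat_pow_consistent)
    then show ?thesis using S assms(1) h.H.group_axioms by (auto simp: p_subgroup_iff)
  qed
  moreover define T where "T = {x \<in> carrier G. h x \<in> S}"
  ultimately have T: "p_subgroup p G T" "\<not> p dvd card (rcosets\<^bsub>G\<^esub> T)"
    using h.p_subgroup_vimage[OF assms(1) pS ker] h.card_rcosets_vimage[OF surj S] m(2) by auto
  have M: "p_subgroup p G M" and max: "\<And>Q. \<lbrakk>p_subgroup p G Q; M \<subseteq> Q\<rbrakk> \<Longrightarrow> Q = M"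
    using assms(3) by (auto simp: sylow_subgroup_def)
  have subT: "subgroup T G" and MG: "M \<subseteq> carrier G"
    using T(1) M subgroup.subset by (auto simp: p_subgroup_def)
  obtain g where g: "g \<in> carrier G" "\<And>q. q \<in> M \<Longrightarrow> g \<otimes>\<^bsub>G\<^esub> q \<otimes>\<^bsub>G\<^esub> inv\<^bsub>G\<^esub> g \<in> T"
    using h.G.p_subgroup_conjugate_into[OF assms(1) M subT T(2)] by blast
  interpret c: group_hom G G "\<lambda>x. g \<otimes>\<^bsub>G\<^esub> x \<otimes>\<^bsub>G\<^esub> inv\<^bsub>G\<^esub> g"
    by (rule h.G.conjugation_group_hom[OF g(1)])
  have ker_c: "\<exists>k. x [^]\<^bsub>G\<^esub> (p ^ k :: nat) = \<one>\<^bsub>G\<^esub>"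
    if "x \<in> carrier G" "g \<otimes>\<^bsub>G\<^esub> x \<otimes>\<^bsub>G\<^esub> inv\<^bsub>G\<^esub> g = \<one>\<^bsub>G\<^esub>" for x
  proof -
    have "x = \<one>\<^bsub>G\<^esub>"
      using h.G.conjugation_is_inj[OF g(1) that(1) h.G.one_closed] that g(1) by simp
    then show ?thesis by simp
  qed
  have "x \<in> (\<lambda>x. g \<otimes>\<^bsub>G\<^esub> x \<otimes>\<^bsub>G\<^esub> inv\<^bsub>G\<^esub> g) ` carrier G" if "x \<in> carrier G" for x
    using that g(1) h.G.conjugation_is_surj[OF g(1) that]
    by (intro image_eqI[of _ _ "inv\<^bsub>G\<^esub> g \<otimes>\<^bsub>G\<^esub> x \<otimes>\<^bsub>G\<^esub> g"]) auto
  then have surj_c: "(\<lambda>x. g \<otimes>\<^bsub>G\<^esub> x \<otimes>\<^bsub>G\<^esub> inv\<^bsub>G\<^esub> g) ` carrier G = carrier G"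
    using g(1) by auto
  \<comment> \<open>This preimage of \<open>T\<close> is a p-subgroup containing \<open>M\<close>,
    as conjugation is injective.\<close>
  have "{x \<in> carrier G. g \<otimes>\<^bsub>G\<^esub> x \<otimes>\<^bsub>G\<^esub> inv\<^bsub>G\<^esub> g \<in> T} = M"
    using g(2) MG by (intro max c.p_subgroup_vimage[OF assms(1) T(1) ker_c]) auto
  then show ?thesis using c.card_rcosets_vimage[OF surj_c subT] T(2) by simp
qed

section \<open>Sylow subgroups of normal subgroups and of homomorphic images\<close>

text \<open>A p-subgroup \<open>Q\<close> of \<open>N\<close> has a conjugate inside
  \<open>M\<close>, and normality keeps this conjugate in \<open>N\<close>. Torsion and the index
  are the hypotheses so that the result also applies to a homomorphic image, with the whole group as
  \<open>N\<close>.\<close>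

lemma sylow_subgroup_Int_normal:
  assumes "prime p" and tors: "\<And>x. x \<in> carrier G \<Longrightarrow> \<exists>n>0. x [^]\<^bsub>G\<^esub> (n :: nat) = \<one>\<^bsub>G\<^esub>"
    and M: "p_subgroup p G M" "\<not> p dvd card (rcosets\<^bsub>G\<^esub> M)" and "N \<lhd> G"
  shows "sylow_subgroup p (G\<lparr>carrier := N\<rparr>) (M \<inter> N)"
proof -
  interpret N: normal N G by fact
  have subM: "subgroup M G" using M by (simp add: p_subgroup_def)
  have MN: "p_subgroup p G (M \<inter> N)"
    using M N.subgroups_Inter_pair[OF subM N.subgroup_axioms] assms(1) N.is_group
    by (auto simp: p_subgroup_iff)
  have "Q = M \<inter> N" if Q: "p_subgroup p G Q" "M \<inter> N \<subseteq> Q" "Q \<subseteq> N" for Q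
  proof -
    obtain g where g: "g \<in> carrier G" "\<And>q. q \<in> Q \<Longrightarrow> g \<otimes>\<^bsub>G\<^esub> q \<otimes>\<^bsub>G\<^esub> inv\<^bsub>G\<^esub> g \<in> M"
      using N.p_subgroup_conjugate_into[OF assms(1) Q(1) subM M(2)] by blast
    have QG: "Q \<subseteq> carrier G" using Q(3) N.subset by auto
    have conj: "g \<otimes>\<^bsub>G\<^esub> q \<otimes>\<^bsub>G\<^esub> inv\<^bsub>G\<^esub> g \<in> M \<inter> N" if "q \<in> Q" for q
      using g that Q(3) N.inv_op_closed2 by auto
    text \<open>Since \<open>Q\<close> may be infinite, \<open>g Q g\<^sup>-\<^sup>1 \<subseteq> M \<inter> N \<subseteq> Q\<close> alone does not give equality; iterating
      it up to the order of \<open>g\<close> does.\<close>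
    have pow: "g [^]\<^bsub>G\<^esub> n \<otimes>\<^bsub>G\<^esub> q \<otimes>\<^bsub>G\<^esub> inv\<^bsub>G\<^esub> (g [^]\<^bsub>G\<^esub> n) \<in> M \<inter> N"
      if q: "q \<in> Q" and "n > 0" for q and n :: nat
      using \<open>n > 0\<close>
    proof (induction n rule: nat_induct_non_zero)
      case 1
      then show ?case using conj[OF q] g by simp
    next
      case (Suc n)
      have qG: "q \<in> carrier G" using q QG by auto
      have "g \<otimes>\<^bsub>G\<^esub> (g [^]\<^bsub>G\<^esub> n \<otimes>\<^bsub>G\<^esub> q \<otimes>\<^bsub>G\<^esub> inv\<^bsub>G\<^esub> (g [^]\<^bsub>G\<^esub> n)) \<otimes>\<^bsub>G\<^esub> inv\<^bsub>G\<^esub> g \<in> M \<inter> N"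
        using conj Suc.IH Q(2) by blast
      \<comment> \<open>The new factor \<open>g\<close> stands outermost, so the power must split as
        \<open>g\<close> times the n-th power; \<open>nat_pow_Suc\<close> would put \<open>g\<close>
        on the other side.\<close>
      then show ?case
        using g(1) qG N.nat_pow_Suc2[OF g(1), of n]
        by (simp add: N.m_assoc N.inv_mult_group del: N.nat_pow_Suc)
    qed
    obtain n :: nat where n: "n > 0" "g [^]\<^bsub>G\<^esub> n = \<one>\<^bsub>G\<^esub>" using tors[OF g(1)] by blast
    have "q \<in> M \<inter> N" if "q \<in> Q" for q
      using pow[OF that n(1)] n(2) that QG by auto
    then show ?thesis using Q(2) by blast
  qed
  then show ?thesis
    using MN by (auto simp: sylow_subgroup_def N.p_subgroup_restrict_iff[OF N.subgroup_axioms])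
qed

text \<open>Cutting the codomain down to the image supplies the surjectivity required by
  \<open>card_rcosets_image_dvd\<close>.\<close>

lemma (in group_hom) group_hom_onto_image:
  assumes "subgroup K G"
  shows "group_hom (G\<lparr>carrier := K\<rparr>) (H\<lparr>carrier := h ` K\<rparr>) h"
  using G.subgroup_imp_group[OF assms] H.subgroup_imp_group[OF subgroup_img_is_subgroup[OF assms]]
    subgroup.subset[OF assms]
  by (auto simp: group_hom_def group_hom_axioms_def hom_def subset_eq)

text \<open>The index of the image of \<open>M\<close> divides that of \<open>M\<close>, so it is
  still prime to p, and torsion passes to the image.\<close>

lemma (in group_hom) sylow_subgroup_image:
  assumes "prime p" "virtual_p_group p G" "sylow_subgroup p G M"
  shows "sylow_subgroup p (H\<lparr>carrier := h ` carrier G\<rparr>) (h ` M)"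
proof -
  define I where "I = H\<lparr>carrier := h ` carrier G\<rparr>"
  interpret I: group_hom G I h
    using group_hom_onto_image[OF G.subgroup_self] by (simp add: I_def)
  have surj: "h ` carrier G = carrier I" by (simp add: I_def)
  have M: "p_subgroup p G M" "subgroup M G"
    using assms(3) by (auto simp: sylow_subgroup_def p_subgroup_def)
  have "\<exists>n>0. y [^]\<^bsub>I\<^esub> (n :: nat) = \<one>\<^bsub>I\<^esub>" if y: "y \<in> carrier I" for y
  proof -
    obtain x where x: "x \<in> carrier G" "y = h x" using y surj by auto
    obtain n :: nat where "n > 0" "x [^] n = \<one>"
      using virtual_p_group_torsion[OF assms(1,2) x(1)] by blast
    then show ?thesis using x by (metis I.hom_nat_pow I.hom_one)
  qed
  moreover have "\<not> p dvd card (rcosets\<^bsub>I\<^esub> (h ` M))"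
    using I.card_rcosets_image_dvd[OF surj M(2)] sylow_subgroup_index_coprime[OF assms]
    by (meson dvd_trans)
  \<comment> \<open>With the whole group as normal subgroup, the intersection result says that a
    p-subgroup of index prime to p is Sylow.\<close>
  moreover have "carrier I \<lhd> I"
    by (rule I.H.normal_invI[OF I.H.subgroup_self]) auto
  ultimately have "sylow_subgroup p (I\<lparr>carrier := carrier I\<rparr>) (h ` M \<inter> carrier I)"
    using I.p_subgroup_image[OF assms(1) M(1)] by (intro sylow_subgroup_Int_normal assms(1))
  moreover have "h ` M \<inter> carrier I = h ` M"
    using surj subgroup.subset[OF M(2)] by auto
  ultimately show ?thesis by (simp add: I_def)
qed

text \<open>A p-subgroup above the image of \<open>M\<close> pulls back, by injectivity, to a
  p-subgroup above \<open>M\<close>, hence to \<open>M\<close> itself.\<close>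

lemma (in group_hom) sylow_subgroup_inj_image:
  assumes "prime p" "inj_on h (carrier G)" "sylow_subgroup p G M"
  shows "sylow_subgroup p (H\<lparr>carrier := h ` carrier G\<rparr>) (h ` M)"
proof -
  define I where "I = H\<lparr>carrier := h ` carrier G\<rparr>"
  interpret I: group_hom G I h
    using group_hom_onto_image[OF G.subgroup_self] by (simp add: I_def)
  have M: "p_subgroup p G M" and max: "\<And>Q. \<lbrakk>p_subgroup p G Q; M \<subseteq> Q\<rbrakk> \<Longrightarrow> Q = M"
    using assms(3) by (auto simp: sylow_subgroup_def)
  have MG: "M \<subseteq> carrier G" using M subgroup.subset by (auto simp: p_subgroup_def)
  have "Q = h ` M" if Q: "p_subgroup p I Q" "h ` M \<subseteq> Q" for Q
  proof -
    have "\<exists>k. x [^] (p ^ k :: nat) = \<one>" if "x \<in> carrier G" "h x = \<one>\<^bsub>I\<^esub>" for x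
    proof -
      have "x = \<one>" using that assms(2) I.hom_one by (metis G.one_closed inj_onD)
      then show ?thesis by simp
    qed
    then have "{x \<in> carrier G. h x \<in> Q} = M"
      using Q MG by (intro max I.p_subgroup_vimage[OF assms(1)]) auto
    moreover have "Q \<subseteq> h ` carrier G"
      using Q(1) subgroup.subset by (force simp: p_subgroup_def I_def)
    ultimately show ?thesis by auto
  qed
  then show ?thesis
    using I.p_subgroup_image[OF assms(1) M] by (simp add: sylow_subgroup_def flip: I_def)
qed

text \<open>This serves the fibres: with \<open>f\<close> and \<open>g\<close> the two coordinate
  projections, the image of \<open>M \<inter> kernel G B g\<close> under \<open>f\<close> is a fibre
  of \<open>M\<close>. The intersection is Sylow in the kernel, and \<open>f\<close> transports this
  injectively.\<close>

lemma sylow_subgroup_image_kernel: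
  assumes "group_hom G A f" "group_hom G B g"
    and "prime p" "virtual_p_group p G" "sylow_subgroup p G M"
    and inj: "inj_on f (kernel G B g)"
  shows "sylow_subgroup p (A\<lparr>carrier := f ` kernel G B g\<rparr>) (f ` (M \<inter> kernel G B g))"
proof -
  interpret f: group_hom G A f by fact
  interpret g: group_hom G B g by fact
  define K where "K = kernel G B g"
  have K: "K \<lhd> G" unfolding K_def by (rule g.normal_kernel)
  then have subK: "subgroup K G" by (rule normal_imp_subgroup)
  have syl: "sylow_subgroup p (G\<lparr>carrier := K\<rparr>) (M \<inter> K)"
    using sylow_subgroup_Int_normal[OF assms(3) virtual_p_group_torsion[OF assms(3,4)] _
        sylow_subgroup_index_coprime[OF assms(3-5)] K] assms(5)
    by (simp add: sylow_subgroup_def)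
  interpret fK: group_hom "G\<lparr>carrier := K\<rparr>" A f
    using f.homh f.G.subgroup_imp_group[OF subK] subgroup.subset[OF subK]
    by (auto simp: group_hom_def group_hom_axioms_def hom_def subset_eq f.H.group_axioms)
  show ?thesis
    using fK.sylow_subgroup_inj_image[OF assms(3) _ syl] inj by (simp add: K_def)
qed

section \<open>Goursat data of subgroups through the coordinate projections\<close>

context
  fixes A :: "('a, 'm) monoid_scheme" and B :: "('b, 'n) monoid_scheme" and G :: "('a \<times> 'b) set"
  assumes A: "group A" and B: "group B" and G: "subgroup G (A \<times>\<times> B)"
begin

lemma group_hom_fst: "group_hom ((A \<times>\<times> B)\<lparr>carrier := G\<rparr>) A fst"
  and group_hom_snd: "group_hom ((A \<times>\<times> B)\<lparr>carrier := G\<rparr>) B snd"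
  using group.subgroup_imp_group[OF DirProd_group[OF A B] G] A B subgroup.subset[OF G]
  by (auto simp: group_hom_def group_hom_axioms_def hom_def)

lemma proj1_eq_image: "H \<subseteq> G \<Longrightarrow> proj1 A B H = fst ` H"
  and proj2_eq_image: "H \<subseteq> G \<Longrightarrow> proj2 A B H = snd ` H"
  using subgroup.subset[OF G] by (force simp: proj1_def proj2_def)+

lemma fibre1_eq_image:
  assumes "H \<subseteq> G"
  shows "fibre1 A B H = fst ` (H \<inter> kernel ((A \<times>\<times> B)\<lparr>carrier := G\<rparr>) B snd)"
proof -
  have "(a, \<one>\<^bsub>B\<^esub>) \<in> H \<Longrightarrow> a \<in> carrier A" for a
    using assms subgroup.subset[OF G] by auto
  then show ?thesis using assms by (force simp: fibre1_def kernel_def)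
qed

lemma fibre2_eq_image:
  assumes "H \<subseteq> G"
  shows "fibre2 A B H = snd ` (H \<inter> kernel ((A \<times>\<times> B)\<lparr>carrier := G\<rparr>) A fst)"
proof -
  have "(\<one>\<^bsub>A\<^esub>, b) \<in> H \<Longrightarrow> b \<in> carrier B" for b
    using assms subgroup.subset[OF G] by auto
  then show ?thesis using assms by (force simp: fibre2_def kernel_def)
qed

lemma sylow_subgroup_projections_fibres:
  assumes "prime p" "virtual_p_group p ((A \<times>\<times> B)\<lparr>carrier := G\<rparr>)"
    and "sylow_subgroup p ((A \<times>\<times> B)\<lparr>carrier := G\<rparr>) M"
  shows "sylow_subgroup p (A\<lparr>carrier := proj1 A B G\<rparr>) (proj1 A B M)"
    and "sylow_subgroup p (A\<lparr>carrier := fibre1 A B G\<rparr>) (fibre1 A B M)"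
    and "sylow_subgroup p (B\<lparr>carrier := proj2 A B G\<rparr>) (proj2 A B M)"
    and "sylow_subgroup p (B\<lparr>carrier := fibre2 A B G\<rparr>) (fibre2 A B M)"
proof -
  let ?\<Gamma> = "(A \<times>\<times> B)\<lparr>carrier := G\<rparr>"
  have MG: "M \<subseteq> G"
    using assms(3) subgroup.subset by (fastforce simp: sylow_subgroup_def p_subgroup_def)
  have inj: "inj_on fst (kernel ?\<Gamma> B snd)" "inj_on snd (kernel ?\<Gamma> A fst)"
    by (auto simp: kernel_def inj_on_def)
  have ker: "G \<inter> kernel ?\<Gamma> B snd = kernel ?\<Gamma> B snd" "G \<inter> kernel ?\<Gamma> A fst = kernel ?\<Gamma> A fst"
    by (auto simp: kernel_def)
  show "sylow_subgroup p (A\<lparr>carrier := proj1 A B G\<rparr>) (proj1 A B M)"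
    using group_hom.sylow_subgroup_image[OF group_hom_fst assms] MG by (simp add: proj1_eq_image)
  show "sylow_subgroup p (B\<lparr>carrier := proj2 A B G\<rparr>) (proj2 A B M)"
    using group_hom.sylow_subgroup_image[OF group_hom_snd assms] MG by (simp add: proj2_eq_image)
  show "sylow_subgroup p (A\<lparr>carrier := fibre1 A B G\<rparr>) (fibre1 A B M)"
    using sylow_subgroup_image_kernel[OF group_hom_fst group_hom_snd assms inj(1)] MG
    by (simp add: fibre1_eq_image ker)
  show "sylow_subgroup p (B\<lparr>carrier := fibre2 A B G\<rparr>) (fibre2 A B M)"
    using sylow_subgroup_image_kernel[OF group_hom_snd group_hom_fst assms inj(2)] MG
    by (simp add: fibre2_eq_image ker)
qed

section \<open>Recovering a Sylow subgroup from a projection and the opposite fibre\<close>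

text \<open>\<open>N\<close> is an extension of its first projection by its second fibre, the kernel
  of \<open>fst\<close> on \<open>N\<close>. One p-power kills the first coordinate and lands in the
  fibre; another kills the second.\<close>

lemma p_subgroup_of_projection_fibre:
  assumes "prime p" and N: "subgroup N (A \<times>\<times> B)"
    and "p_subgroup p A (proj1 A B N)" "p_subgroup p B (fibre2 A B N)"
  shows "p_subgroup p (A \<times>\<times> B) N"
proof -
  let ?\<Gamma> = "(A \<times>\<times> B)\<lparr>carrier := N\<rparr>"
  interpret P: group "A \<times>\<times> B" by (rule DirProd_group[OF A B])
  interpret f: group_hom "A \<times>\<times> B" A fst
    using A B P.group_axioms by (auto simp: group_hom_def group_hom_axioms_def hom_def)
  interpret s: group_hom "A \<times>\<times> B" B snd
    using A B P.group_axioms by (auto simp: group_hom_def group_hom_axioms_def hom_def)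
  have NP: "N \<subseteq> carrier (A \<times>\<times> B)" by (rule subgroup.subset[OF N])
  have torsA: "\<exists>k. a [^]\<^bsub>A\<^esub> (p ^ k :: nat) = \<one>\<^bsub>A\<^esub>" if "a \<in> proj1 A B N" for a
    using assms(1,3) A that by (auto simp: p_subgroup_iff)
  have torsB: "\<exists>k. b [^]\<^bsub>B\<^esub> (p ^ k :: nat) = \<one>\<^bsub>B\<^esub>" if "b \<in> fibre2 A B N" for b
    using assms(1,4) B that by (auto simp: p_subgroup_iff)
  have "\<exists>k. x [^]\<^bsub>A \<times>\<times> B\<^esub> (p ^ k :: nat) = \<one>\<^bsub>A \<times>\<times> B\<^esub>" if x: "x \<in> N" for x
  proof -
    have xP: "x \<in> carrier (A \<times>\<times> B)" using x NP by auto
    have "fst x \<in> proj1 A B N" using x xP by (cases x) (auto simp: proj1_def)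
    then obtain k where "fst x [^]\<^bsub>A\<^esub> (p ^ k :: nat) = \<one>\<^bsub>A\<^esub>" using torsA by blast
    moreover define y where "y = x [^]\<^bsub>A \<times>\<times> B\<^esub> (p ^ k :: nat)"
    ultimately have y1: "fst y = \<one>\<^bsub>A\<^esub>" using f.hom_nat_pow[OF xP] by simp
    interpret N: group ?\<Gamma> by (rule P.subgroup_imp_group[OF N])
    have y: "y \<in> N"
      using N.nat_pow_closed[of x "p ^ k"] x by (simp add: y_def flip: P.nat_pow_consistent)
    then have yP: "y \<in> carrier (A \<times>\<times> B)" using NP by auto
    have "snd y \<in> fibre2 A B N" using y y1 yP by (cases y) (auto simp: fibre2_def)
    then obtain l where "snd y [^]\<^bsub>B\<^esub> (p ^ l :: nat) = \<one>\<^bsub>B\<^esub>" using torsB by blast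
    then have "y [^]\<^bsub>A \<times>\<times> B\<^esub> (p ^ l :: nat) = \<one>\<^bsub>A \<times>\<times> B\<^esub>"
      using f.hom_nat_pow[OF yP] s.hom_nat_pow[OF yP] y1 by (auto simp: prod_eq_iff)
    then have "x [^]\<^bsub>A \<times>\<times> B\<^esub> (p ^ (k + l) :: nat) = \<one>\<^bsub>A \<times>\<times> B\<^esub>"
      using xP by (simp add: y_def P.nat_pow_pow power_add)
    then show ?thesis by blast
  qed
  then show ?thesis using assms(1) N P.group_axioms by (auto simp: p_subgroup_iff)
qed

text \<open>An element of \<open>Q\<close> differs from an element of \<open>N\<close> with the same
  first coordinate by an element of the common fibre, which lies in \<open>N\<close>.\<close>

lemma subgroup_eq_of_projection_fibre:
  assumes N: "subgroup N (A \<times>\<times> B)" and Q: "subgroup Q (A \<times>\<times> B)" and "N \<subseteq> Q"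
    and proj: "proj1 A B Q = proj1 A B N" and fibre: "fibre2 A B Q = fibre2 A B N"
  shows "Q = N"
proof -
  interpret P: group "A \<times>\<times> B" by (rule DirProd_group[OF A B])
  interpret A: group A by (rule A)
  interpret B: group B by (rule B)
  have "(a, b) \<in> N" if ab: "(a, b) \<in> Q" for a b
  proof -
    have car: "a \<in> carrier A" "b \<in> carrier B" using subgroup.subset[OF Q] ab by auto
    have "a \<in> proj1 A B N" using ab car unfolding proj[symmetric] by (auto simp: proj1_def)
    then obtain c where c: "c \<in> carrier B" "(a, c) \<in> N" by (auto simp: proj1_def)
    have "inv\<^bsub>A \<times>\<times> B\<^esub> (a, c) \<otimes>\<^bsub>A \<times>\<times> B\<^esub> (a, b) \<in> Q"
      using ab c(2) assms(3) by (intro subgroup.m_closed[OF Q] subgroup.m_inv_closed[OF Q]) auto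
    then have "inv\<^bsub>B\<^esub> c \<otimes>\<^bsub>B\<^esub> b \<in> fibre2 A B Q"
      using car c A B by (simp add: fibre2_def)
    then have "(\<one>\<^bsub>A\<^esub>, inv\<^bsub>B\<^esub> c \<otimes>\<^bsub>B\<^esub> b) \<in> N"
      unfolding fibre by (simp add: fibre2_def)
    then have "(a, c) \<otimes>\<^bsub>A \<times>\<times> B\<^esub> (\<one>\<^bsub>A\<^esub>, inv\<^bsub>B\<^esub> c \<otimes>\<^bsub>B\<^esub> b) \<in> N"
      by (rule subgroup.m_closed[OF N c(2)])
    then show ?thesis using car c by (simp flip: B.m_assoc)
  qed
  then show ?thesis using assms(3) by auto
qed

text \<open>For a p-subgroup \<open>Q\<close> between \<open>N\<close> and \<open>G\<close>, the
  first projection and second fibre are p-subgroups above those of \<open>N\<close>. Maximality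
  makes them equal, which forces \<open>Q = N\<close>.\<close>

lemma sylow_subgroup_of_projection_fibre:
  assumes "prime p" and N: "subgroup N (A \<times>\<times> B)" "N \<subseteq> G"
    and proj: "sylow_subgroup p (A\<lparr>carrier := proj1 A B G\<rparr>) (proj1 A B N)"
    and fibre: "sylow_subgroup p (B\<lparr>carrier := fibre2 A B G\<rparr>) (fibre2 A B N)"
  shows "sylow_subgroup p ((A \<times>\<times> B)\<lparr>carrier := G\<rparr>) N"
proof -
  interpret P: group "A \<times>\<times> B" by (rule DirProd_group[OF A B])
  interpret f: group_hom "(A \<times>\<times> B)\<lparr>carrier := G\<rparr>" A fst by (rule group_hom_fst)
  interpret s: group_hom "(A \<times>\<times> B)\<lparr>carrier := G\<rparr>" B snd by (rule group_hom_snd)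
  note iffG = P.p_subgroup_restrict_iff[OF G]
  note iff1 = f.H.p_subgroup_restrict_iff[OF proj1_subgroup[OF A B G]]
  note iff2 = s.H.p_subgroup_restrict_iff[OF fibre2_subgroup[OF A B G]]
  have "Q = N" if Q: "p_subgroup p (A \<times>\<times> B) Q" "Q \<subseteq> G" "N \<subseteq> Q" for Q
  proof (rule subgroup_eq_of_projection_fibre[OF N(1) _ Q(3)])
    show subQ: "subgroup Q (A \<times>\<times> B)" using Q(1) by (simp add: p_subgroup_def)
    have QG: "p_subgroup p ((A \<times>\<times> B)\<lparr>carrier := G\<rparr>) Q" using Q iffG by simp
    have "p_subgroup p A (proj1 A B Q)"
      using f.p_subgroup_image[OF assms(1) QG] Q(2) by (simp add: proj1_eq_image)
    moreover have "proj1 A B N \<subseteq> proj1 A B Q" "proj1 A B Q \<subseteq> proj1 A B G"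
      using Q(2,3) by (auto simp: proj1_def)
    ultimately show "proj1 A B Q = proj1 A B N"
      using proj by (simp add: sylow_subgroup_def iff1)
    \<comment> \<open>The fibre inherits p-power torsion from the second projection of
      \<open>Q\<close>, which contains it and is an image of a p-group.\<close>
    have "subgroup (fibre2 A B Q) B" by (rule fibre2_subgroup[OF A B subQ])
    moreover have "p_subgroup p B (proj2 A B Q)"
      using s.p_subgroup_image[OF assms(1) QG] Q(2) by (simp add: proj2_eq_image)
    moreover have "fibre2 A B Q \<subseteq> proj2 A B Q" by (auto simp: fibre2_def proj2_def)
    ultimately have "p_subgroup p B (fibre2 A B Q)"
      using assms(1) B by (auto simp: p_subgroup_iff)
    moreover have "fibre2 A B N \<subseteq> fibre2 A B Q" "fibre2 A B Q \<subseteq> fibre2 A B G"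
      using Q(2,3) by (auto simp: fibre2_def)
    ultimately show "fibre2 A B Q = fibre2 A B N"
      using fibre by (simp add: sylow_subgroup_def iff2)
  qed
  moreover have "p_subgroup p (A \<times>\<times> B) N"
    using p_subgroup_of_projection_fibre[OF assms(1) N(1)] proj fibre
    by (simp add: sylow_subgroup_def iff1 iff2)
  ultimately show ?thesis using N(2) by (auto simp: sylow_subgroup_def iffG)
qed

end

theorem theorem4p9:
  fixes p :: nat
    and A :: "('a, 'm) monoid_scheme" and B :: "('b, 'n) monoid_scheme"
    and G :: "('a \<times> 'b) set"
  assumes "prime p"
    and "group A" and "group B"
    and "subgroup G (A \<times>\<times> B)"
    and "virtual_p_group p ((A \<times>\<times> B)\<lparr>carrier := G\<rparr>)"
  shows "(\<forall>M. sylow_subgroup p ((A \<times>\<times> B)\<lparr>carrier := G\<rparr>) M \<longrightarrow>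
            sylow_subgroup p (A\<lparr>carrier := proj1 A B G\<rparr>) (proj1 A B M) \<and>
            sylow_subgroup p (A\<lparr>carrier := fibre1 A B G\<rparr>) (fibre1 A B M) \<and>
            sylow_subgroup p (B\<lparr>carrier := proj2 A B G\<rparr>) (proj2 A B M) \<and>
            sylow_subgroup p (B\<lparr>carrier := fibre2 A B G\<rparr>) (fibre2 A B M))
       \<and> (\<forall>N bN1 N1 bN2 N2 \<theta>.
            subgroup N ((A \<times>\<times> B)\<lparr>carrier := G\<rparr>) \<and>
            goursat_quintuple A B N = (bN1, N1, bN2, N2, \<theta>) \<and>
            sylow_subgroup p (A\<lparr>carrier := proj1 A B G\<rparr>) bN1 \<and>
            sylow_subgroup p (A\<lparr>carrier := fibre1 A B G\<rparr>) N1 \<and>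
            sylow_subgroup p (B\<lparr>carrier := proj2 A B G\<rparr>) bN2 \<and>
            sylow_subgroup p (B\<lparr>carrier := fibre2 A B G\<rparr>) N2 \<longrightarrow>
            sylow_subgroup p ((A \<times>\<times> B)\<lparr>carrier := G\<rparr>) N)"
proof (intro conjI allI impI; (elim conjE)?)
  fix M assume M: "sylow_subgroup p ((A \<times>\<times> B)\<lparr>carrier := G\<rparr>) M"
  note parts = sylow_subgroup_projections_fibres[OF assms(2-4,1,5) M]
  show "sylow_subgroup p (A\<lparr>carrier := proj1 A B G\<rparr>) (proj1 A B M)"
    and "sylow_subgroup p (A\<lparr>carrier := fibre1 A B G\<rparr>) (fibre1 A B M)"
    and "sylow_subgroup p (B\<lparr>carrier := proj2 A B G\<rparr>) (proj2 A B M)"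
    and "sylow_subgroup p (B\<lparr>carrier := fibre2 A B G\<rparr>) (fibre2 A B M)"
    by (rule parts)+
next
  fix N bN1 N1 bN2 N2 \<theta>
  assume N: "subgroup N ((A \<times>\<times> B)\<lparr>carrier := G\<rparr>)"
    and quint: "goursat_quintuple A B N = (bN1, N1, bN2, N2, \<theta>)"
    and bN1: "sylow_subgroup p (A\<lparr>carrier := proj1 A B G\<rparr>) bN1"
    and N2: "sylow_subgroup p (B\<lparr>carrier := fibre2 A B G\<rparr>) N2"
  have "subgroup N (A \<times>\<times> B)"
    by (rule group.incl_subgroup[OF DirProd_group[OF assms(2,3)] assms(4) N])
  moreover have "N \<subseteq> G" using subgroup.subset[OF N] by simp
  ultimately show "sylow_subgroup p ((A \<times>\<times> B)\<lparr>carrier := G\<rparr>) N"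
    using quint bN1 N2
    by (intro sylow_subgroup_of_projection_fibre assms) (auto simp: goursat_quintuple_def)
qed

end
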